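(* Let $\mathcal{X} \subseteq \mathbb{R}^p$, let $c:\mathbb{R}^p\times\mathbb{R}^n\to\mathbb{R}$ and $g:\mathbb{R}^p\times\mathbb{R}^n\to\mathbb{R}^m$ be functions (no convexity or continuity is assumed), and let $\mathcal{Y}(\mathbf{x})=\{\mathbf{y}\in\mathbb{R}^n : g(\mathbf{x},\mathbf{y})\le 0\}$. Assume that for every $\mathbf{x}\in\mathcal{X}$ the problem $\min_{\mathbf{y}\in\mathcal{Y}(\mathbf{x})} c(\mathbf{x},\mathbf{y})$ has at least one optimal solution. Let $f_\theta:\mathcal{X}\to\mathbb{R}^n$ be an optimization proxy, i.e. a function with $f_\theta(\mathbf{x})\in\mathcal{Y}(\mathbf{x})$ for all $\mathbf{x}\in\mathcal{X}$. Then the bilevel optimality verification problem $$\max_{\mathbf{x}\in\mathcal{X},\,\mathbf{y}^*}\ c(\mathbf{x},f_\theta(\mathbf{x}))-c(\mathbf{x},\mathbf{y}^* )\quad\text{s.t.}\quad \mathbf{y}^*\in\operatorname*{arg\,min}_{\mathbf{y}\in\mathcal{Y}(\mathbf{x})} c(\mathbf{x},\mathbf{y})$$ and the compact optimality verification problem $$\max_{\mathbf{x}\in\mathcal{X},\,\mathbf{y}}\ c(\mathbf{x},\hat{\mathbf{y}})-c(\mathbf{x},\mathbf{y})\quad\text{s.t.}\quad \hat{\mathbf{y}}=f_\theta(\mathbf{x}),\ \ \mathbf{y}\in\mathcal{Y}(\mathbf{x})$$ have the same optimum (optimal value).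
   Context: The inequality $g(\mathbf{x},\mathbf{y})\le 0$ is understood componentwise. $\mathcal{X}$ is the set of possible input parameters, and $\mathcal{Y}(\mathbf{x})$ is the feasible set of the parametric optimization problem $P(\mathbf{x}):\ \min_{\mathbf{y}} c(\mathbf{x},\mathbf{y})$ s.t. $g(\mathbf{x},\mathbf{y})\le 0$. The set $\operatorname*{arg\,min}_{\mathbf{y}\in\mathcal{Y}(\mathbf{x})} c(\mathbf{x},\mathbf{y})$ is the set of optimal solutions of $P(\mathbf{x})$. In the bilevel problem, the feasible points are the pairs $(\mathbf{x},\mathbf{y}^* )$ with $\mathbf{x}\in\mathcal{X}$ and $\mathbf{y}^*$ an optimal solution of $P(\mathbf{x})$; in the compact problem, they are the pairs $(\mathbf{x},\mathbf{y})$ with $\mathbf{x}\in\mathcal{X}$ and $\mathbf{y}\in\mathcal{Y}(\mathbf{x})$. The optimal value of a maximization problem is the supremum, in the extended reals, of its objective over its feasible points. *)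

theory Defs
  imports "HOL-Analysis.Analysis"
begin

(* The order on real ^ 'm is the componentwise one, so g x y \<le> 0 means g_i(x, y) \<le> 0 for all i. *)
definition feasible_set ::
  "(real ^ 'p \<Rightarrow> real ^ 'n \<Rightarrow> real ^ 'm) \<Rightarrow> real ^ 'p \<Rightarrow> (real ^ 'n) set" where
  "feasible_set g x = {y. g x y \<le> 0}"

definition optimal_solutions ::
  "(real ^ 'p \<Rightarrow> real ^ 'n \<Rightarrow> real) \<Rightarrow> (real ^ 'p \<Rightarrow> real ^ 'n \<Rightarrow> real ^ 'm) \<Rightarrow>
   real ^ 'p \<Rightarrow> (real ^ 'n) set" where
  "optimal_solutions c g x = {y. is_arg_min (c x) (\<lambda>y. y \<in> feasible_set g x) y}"

(* The proxy f is total; only its values on X matter. *)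
definition optimization_proxy ::
  "(real ^ 'p) set \<Rightarrow> (real ^ 'p \<Rightarrow> real ^ 'n \<Rightarrow> real ^ 'm) \<Rightarrow>
   (real ^ 'p \<Rightarrow> real ^ 'n) \<Rightarrow> bool" where
  "optimization_proxy X g f \<longleftrightarrow> (\<forall>x\<in>X. f x \<in> feasible_set g x)"

definition bilevel_feasible ::
  "(real ^ 'p) set \<Rightarrow> (real ^ 'p \<Rightarrow> real ^ 'n \<Rightarrow> real) \<Rightarrow>
   (real ^ 'p \<Rightarrow> real ^ 'n \<Rightarrow> real ^ 'm) \<Rightarrow> ((real ^ 'p) \<times> (real ^ 'n)) set" where
  "bilevel_feasible X c g = {(x, y). x \<in> X \<and> y \<in> optimal_solutions c g x}"

definition compact_feasible ::
  "(real ^ 'p) set \<Rightarrow> (real ^ 'p \<Rightarrow> real ^ 'n \<Rightarrow> real ^ 'm) \<Rightarrow> ((real ^ 'p) \<times> (real ^ 'n)) set" where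
  "compact_feasible X g = {(x, y). x \<in> X \<and> y \<in> feasible_set g x}"

(* The value is -\<infinity> for an infeasible problem and \<infinity> for an unbounded one. *)
definition max_value :: "('a \<Rightarrow> real) \<Rightarrow> 'a set \<Rightarrow> ereal" where
  "max_value obj F = (SUP z\<in>F. ereal (obj z))"

end

theory Submission
  imports Defs
begin

text \<open>Relaxing the inner optimality condition to mere feasibility enlarges the feasible set, so the
  compact value is at least the bilevel one. No value is gained, however: the term
  \<open>c x (f x)\<close> does not depend on \<open>y\<close>, so maximizing over \<open>y\<close> for fixed \<open>x\<close> is the same as
  minimizing \<open>c x y\<close>. Replacing \<open>y\<close> by an optimal solution for the same \<open>x\<close> therefore never
  lowers the objective, and it leads back into the bilevel feasible set.\<close>

lemma max_value_eq_dominating_subset: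
  assumes "F \<subseteq> G" and "\<And>z. z \<in> G \<Longrightarrow> \<exists>w\<in>F. obj z \<le> obj w"
  shows "max_value obj F = max_value obj G"
  unfolding max_value_def
proof (rule antisym)
  show "(SUP z\<in>F. ereal (obj z)) \<le> (SUP z\<in>G. ereal (obj z))"
    using assms(1) by (rule SUP_subset_mono) simp
  show "(SUP z\<in>G. ereal (obj z)) \<le> (SUP z\<in>F. ereal (obj z))"
    by (rule SUP_mono) (simp add: assms(2))
qed

lemma optimal_solutions_iff:
  "y \<in> optimal_solutions c g x \<longleftrightarrow>
     y \<in> feasible_set g x \<and> (\<forall>z\<in>feasible_set g x. c x y \<le> c x z)"
  by (auto simp: optimal_solutions_def is_arg_min_linorder)

theorem theorem4p1:
  fixes X :: "(real ^ 'p) set"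
    and c :: "real ^ 'p \<Rightarrow> real ^ 'n \<Rightarrow> real"
    and g :: "real ^ 'p \<Rightarrow> real ^ 'n \<Rightarrow> real ^ 'm"
    and f :: "real ^ 'p \<Rightarrow> real ^ 'n"
  assumes "\<forall>x\<in>X. optimal_solutions c g x \<noteq> {}"
    and "optimization_proxy X g f"
  shows "max_value (\<lambda>(x, y). c x (f x) - c x y) (bilevel_feasible X c g) =
         max_value (\<lambda>(x, y). let y_hat = f x in c x y_hat - c x y) (compact_feasible X g)"
  unfolding Let_def
proof (rule max_value_eq_dominating_subset)
  show "bilevel_feasible X c g \<subseteq> compact_feasible X g"
    by (auto simp: bilevel_feasible_def compact_feasible_def optimal_solutions_iff)
next
  fix z assume "z \<in> compact_feasible X g"
  then obtain x y where z: "z = (x, y)" and x: "x \<in> X" and y: "y \<in> feasible_set g x"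
    by (auto simp: compact_feasible_def)
  from assms(1) x obtain y' where y': "y' \<in> optimal_solutions c g x"
    by blast
  have "(x, y') \<in> bilevel_feasible X c g"
    using x y' by (simp add: bilevel_feasible_def)
  moreover have "c x y' \<le> c x y"
    using y y' by (simp add: optimal_solutions_iff)
  ultimately show "\<exists>w\<in>bilevel_feasible X c g.
      (case z of (x, y) \<Rightarrow> c x (f x) - c x y) \<le> (case w of (x, y) \<Rightarrow> c x (f x) - c x y)"
    by (intro bexI[of _ "(x, y')"]) (simp_all add: z)
qed

end
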